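(* For every $n\ge 7$, every Gallai-3-coloring of $K_n$ contains a $3$-connected subgraph of order at least $n-1$ using at most two colors.
   Context: A Gallai-3-coloring of $K_n$ is an edge-coloring of $K_n$ with three colors, all three of which appear, containing no rainbow triangle (a triangle whose three edges have pairwise different colors). The order of a graph is its number of vertices. A subgraph uses at most two colors if its edges receive at most two colors in total. *)

theory Defs
  imports Main
begin

text \<open>
  Finite simple graphs are given by a vertex set \<open>W\<close> and an edge set \<open>F\<close>, an edge being
  a two-element set of vertices.
\<close>

definition complete_edges :: "'a set \<Rightarrow> 'a set set" where
  "complete_edges V = {e. e \<subseteq> V \<and> card e = 2}"

definition graph :: "'a set \<Rightarrow> 'a set set \<Rightarrow> bool" where
  "graph W F \<longleftrightarrow> finite W \<and> F \<subseteq> complete_edges W"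

definition subgraph :: "'a set \<Rightarrow> 'a set set \<Rightarrow> 'a set \<Rightarrow> 'a set set \<Rightarrow> bool" where
  "subgraph W F V E \<longleftrightarrow> graph W F \<and> graph V E \<and> W \<subseteq> V \<and> F \<subseteq> E"

definition connected_graph :: "'a set \<Rightarrow> 'a set set \<Rightarrow> bool" where
  "connected_graph W F \<longleftrightarrow>
     W \<noteq> {} \<and> (\<forall>u\<in>W. \<forall>v\<in>W. (u, v) \<in> {(x, y). {x, y} \<in> F}\<^sup>*)"

text \<open>
  The usual convention: a \<open>k\<close>-connected graph has more than \<open>k\<close> vertices, and deleting
  fewer than \<open>k\<close> of them never disconnects it. So the complete graph on \<open>k + 1\<close> vertices is
  \<open>k\<close>-connected, the one on \<open>k\<close> vertices is not.
\<close>

definition k_connected :: "nat \<Rightarrow> 'a set \<Rightarrow> 'a set set \<Rightarrow> bool" where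
  "k_connected k W F \<longleftrightarrow> graph W F \<and> card W > k \<and>
     (\<forall>S. S \<subseteq> W \<and> card S < k \<longrightarrow> connected_graph (W - S) {e \<in> F. e \<inter> S = {}})"

text \<open>
  A colouring is a function on edges; only its values on \<open>complete_edges V\<close> matter. That all
  three colours appear is expressed by the image having exactly three elements.
\<close>

definition gallai_3_coloring :: "'a set \<Rightarrow> ('a set \<Rightarrow> 'c) \<Rightarrow> bool" where
  "gallai_3_coloring V c \<longleftrightarrow> card (c ` complete_edges V) = 3 \<and>
     \<not> (\<exists>x\<in>V. \<exists>y\<in>V. \<exists>z\<in>V. x \<noteq> y \<and> y \<noteq> z \<and> x \<noteq> z \<and>
          c {x, y} \<noteq> c {y, z} \<and> c {y, z} \<noteq> c {x, z} \<and> c {x, y} \<noteq> c {x, z})"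

end

theory Submission
  imports Defs
begin

text \<open>
  Deleting the edges of one colour \<open>i\<close> leaves a graph in two colours, and that graph is
  disconnected on a vertex set \<open>U\<close> exactly when \<open>U\<close> falls into two nonempty sides with all
  edges between them of colour \<open>i\<close>; then \<open>U\<close> is called split by \<open>i\<close>. So it suffices to find a
  colour \<open>i\<close> and a set \<open>W\<close> of at least \<open>n - 1\<close> vertices such that no set obtained from \<open>W\<close>
  by deleting at most two vertices is split by \<open>i\<close>; such a \<open>W\<close> is called robust for \<open>i\<close>.

  Gallai's theorem enters in the form of a dichotomy (\<open>split_or_robust\<close>): every set of at least
  two vertices is split by some colour or is itself robust for some colour. Indeed, some
  colour \<open>k\<close> is disconnected (\<open>ex_disconnected_color\<close>). Without colour \<open>k\<close> there
  remains a graph containing the complete multipartite graph whose parts are the components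
  of colour \<open>k\<close>, and this is robust unless a single component misses at most two vertices. Each missed
  vertex sees that component in one colour, which yields a split.

  Apply the dichotomy to the whole vertex set, and suppose that it is split by \<open>p\<close>. If both sides
  have at least three vertices, any other colour may be dropped. If the small side is a
  single vertex, apply the dichotomy to the other side, which has \<open>n - 1\<close> vertices. If that is
  split by \<open>q\<close> with at least two vertices on its small side, then these and the single vertex are
  three vertices joined to all the others in colours \<open>p\<close> and \<open>q\<close>, and a third colour may be
  dropped. In the remaining cases there are just two vertices, each joined in one
  colour to all the others. They are settled in \<open>two_apexes\<close>, where the key point is that a set
  cannot be split by two different colours: if one choice of the colour to be dropped fails on
  the remaining vertices, another one works.
\<close>

section \<open>Splits and robust sets\<close>

definition split_by :: "('a set \<Rightarrow> 'c) \<Rightarrow> 'c \<Rightarrow> 'a set \<Rightarrow> bool" where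
  "split_by c i U \<longleftrightarrow> (\<exists>X Y. X \<noteq> {} \<and> Y \<noteq> {} \<and> X \<inter> Y = {} \<and> X \<union> Y = U \<and>
     (\<forall>x\<in>X. \<forall>y\<in>Y. c {x, y} = i))"

definition avoids :: "('a set \<Rightarrow> 'c) \<Rightarrow> 'c \<Rightarrow> 'a set \<Rightarrow> 'a set \<Rightarrow> bool" where
  "avoids c i X Y \<longleftrightarrow> (\<forall>x\<in>X. \<forall>y\<in>Y. c {x, y} \<noteq> i)"

definition robust :: "('a set \<Rightarrow> 'c) \<Rightarrow> 'c \<Rightarrow> 'a set \<Rightarrow> bool" where
  "robust c i W \<longleftrightarrow> (\<forall>S. S \<subseteq> W \<and> card S \<le> 2 \<longrightarrow> \<not> split_by c i (W - S))"

lemma split_byI: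
  assumes "X \<noteq> {}" "Y \<noteq> {}" "X \<inter> Y = {}" "X \<union> Y = U" "\<And>x y. x \<in> X \<Longrightarrow> y \<in> Y \<Longrightarrow> c {x, y} = i"
  shows "split_by c i U"
  unfolding split_by_def using assms by (intro exI[of _ X] exI[of _ Y]) simp

lemma avoids_sym: "avoids c i X Y \<Longrightarrow> avoids c i Y X"
  unfolding avoids_def by (intro ballI, subst insert_commute) blast

lemma avoids_mono: "avoids c i X Y \<Longrightarrow> X' \<subseteq> X \<Longrightarrow> Y' \<subseteq> Y \<Longrightarrow> avoids c i X' Y'"
  unfolding avoids_def by blast

text \<open>
  The smaller side is listed first, which saves a symmetric case whenever a split is used.
\<close>

lemma split_byE:
  assumes "split_by c i U" "finite U"
  obtains X Y where "X \<noteq> {}" "Y \<noteq> {}" "X \<inter> Y = {}" "X \<union> Y = U"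
    "\<forall>x\<in>X. \<forall>y\<in>Y. c {x, y} = i" "card X \<le> card Y" "card X + card Y = card U"
    "finite X" "finite Y"
proof -
  obtain X Y where *: "X \<noteq> {}" "Y \<noteq> {}" "X \<inter> Y = {}" "X \<union> Y = U"
      "\<forall>x\<in>X. \<forall>y\<in>Y. c {x, y} = i"
    using assms(1) unfolding split_by_def by blast
  have fin: "finite X" "finite Y" using * assms(2) by auto
  have card: "card X + card Y = card U"
    using card_Un_disjoint[OF fin] * by simp
  show thesis
  proof (cases "card X \<le> card Y")
    case True
    then show thesis by (intro that[of X Y] * fin card)
  next
    case False
    have "\<forall>y\<in>Y. \<forall>x\<in>X. c {y, x} = i" using *(5) by (metis insert_commute)
    moreover have "Y \<inter> X = {}" "Y \<union> X = U" "card Y \<le> card X" "card Y + card X = card U"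
      using *(3,4) card False by auto
    ultimately show thesis by (intro that[of Y X] *(1,2) fin)
  qed
qed

text \<open>
  A complete bipartite graph is connected: the sides of a split by \<open>i\<close> cannot be crossed by
  edges of other colours.
\<close>

lemma not_split_by_bipartite:
  assumes "A \<noteq> {}" "B \<noteq> {}" "avoids c i A B"
  shows "\<not> split_by c i (A \<union> B)"
proof
  assume "split_by c i (A \<union> B)"
  then obtain X Y where *: "X \<noteq> {}" "Y \<noteq> {}" "X \<union> Y = A \<union> B"
      "\<forall>x\<in>X. \<forall>y\<in>Y. c {x, y} = i"
    unfolding split_by_def by blast
  have "c {b, a} \<noteq> i \<and> c {a, b} \<noteq> i" if "a \<in> A" "b \<in> B" for a b
    using that assms(3) avoids_sym unfolding avoids_def by metis
  then have same: "a \<in> X \<longleftrightarrow> b \<in> X" "a \<in> Y \<longleftrightarrow> b \<in> Y" if "a \<in> A" "b \<in> B" for a b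
    using that *(3,4) by blast+
  obtain a0 b0 where "a0 \<in> A" "b0 \<in> B" using assms by blast
  then have "a0 \<in> X \<and> b0 \<in> X \<and> a0 \<in> Y \<and> b0 \<in> Y"
    using same *(1-3) by blast
  then have "c {a0, b0} = i" using *(4) by blast
  then show False using assms(3) \<open>a0 \<in> A\<close> \<open>b0 \<in> B\<close> unfolding avoids_def by blast
qed

lemma not_split_by_two_colors:
  assumes "split_by c i U" "i \<noteq> j"
  shows "\<not> split_by c j U"
proof -
  obtain X Y where "X \<noteq> {}" "Y \<noteq> {}" "X \<union> Y = U" "\<forall>x\<in>X. \<forall>y\<in>Y. c {x, y} = i"
    using assms(1) unfolding split_by_def by blast
  then show ?thesis
    using not_split_by_bipartite[of X Y c j] assms(2) unfolding avoids_def by auto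
qed

text \<open>
  The hypothesis says that the remaining graph contains a complete multipartite graph in which
  every part misses at least three vertices: two deletions cannot leave just one part.
\<close>

lemma robust_multipartite:
  assumes "finite W" "card W \<ge> 3"
    and part: "\<And>w. w \<in> W \<Longrightarrow> \<exists>P\<subseteq>W. w \<in> P \<and> card (W - P) \<ge> 3 \<and> avoids c i P (W - P)"
  shows "robust c i W"
  unfolding robust_def
proof (intro allI impI)
  fix S assume S: "S \<subseteq> W \<and> card S \<le> 2"
  then have "W \<noteq> S" using assms(2) by auto
  then have "W - S \<noteq> {}" using S by blast
  then obtain w where w: "w \<in> W" "w \<notin> S" by blast
  obtain P where P: "P \<subseteq> W" "w \<in> P" "card (W - P) \<ge> 3" "avoids c i P (W - P)"
    using part[OF w(1)] by blast
  have "\<not> W - P \<subseteq> S"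
  proof
    assume "W - P \<subseteq> S"
    then have "card (W - P) \<le> card S"
      using S assms(1) by (meson card_mono finite_subset)
    with S P(3) show False by simp
  qed
  then have "\<not> split_by c i ((P - S) \<union> (W - P - S))"
    using w P by (intro not_split_by_bipartite) (auto intro: avoids_mono)
  moreover have "(P - S) \<union> (W - P - S) = W - S" using P(1) by blast
  ultimately show "\<not> split_by c i (W - S)" by simp
qed

lemma robust_bipartite:
  assumes "finite A" "finite B" "card A \<ge> 3" "card B \<ge> 3" "A \<inter> B = {}" "avoids c i A B"
  shows "robust c i (A \<union> B)"
proof (rule robust_multipartite)
  show "finite (A \<union> B)" using assms by simp
  show "card (A \<union> B) \<ge> 3"
    using assms card_mono[of "A \<union> B" A] by simp
  have diff: "A \<union> B - A = B" "A \<union> B - B = A" using assms(5) by auto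
  fix w assume "w \<in> A \<union> B"
  then show "\<exists>P\<subseteq>A \<union> B. w \<in> P \<and> card (A \<union> B - P) \<ge> 3 \<and> avoids c i P (A \<union> B - P)"
  proof
    assume "w \<in> A"
    then show ?thesis using assms diff by (intro exI[of _ A]) simp
  next
    assume "w \<in> B"
    then show ?thesis using assms diff avoids_sym[of c i A B] by (intro exI[of _ B]) simp
  qed
qed

text \<open>
  To separate a double cone, both apexes have to be deleted, and then the base is left whole.
\<close>

lemma robust_double_cone:
  assumes "finite B" "card B \<ge> 3" "a \<notin> B" "b \<notin> B" "a \<noteq> b"
    and "avoids c i {a, b} B" "\<not> split_by c i B"
  shows "robust c i ({a, b} \<union> B)"
  unfolding robust_def
proof (intro allI impI)
  fix S assume S: "S \<subseteq> {a, b} \<union> B \<and> card S \<le> 2"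
  then have fS: "finite S" using assms(1) by (meson finite.simps finite_UnI finite_subset)
  show "\<not> split_by c i ({a, b} \<union> B - S)"
  proof (cases "{a, b} \<subseteq> S")
    case True
    then have "{a, b} = S"
      using S assms(5) fS by (intro card_seteq) auto
    then have "{a, b} \<union> B - S = B" using assms(3,4) by blast
    then show ?thesis using assms(7) by simp
  next
    case False
    have "\<not> B \<subseteq> S" using S assms(2) card_mono[OF fS, of B] by auto
    then have "\<not> split_by c i (({a, b} - S) \<union> (B - S))"
      using False assms(6) by (intro not_split_by_bipartite) (auto intro: avoids_mono)
    then show ?thesis by (simp only: Un_Diff not_False_eq_True)
  qed
qed

section \<open>From robust sets to connectivity\<close>

text \<open>
  The vertices reachable from a given one form one side of a split, unless they are all of \<open>U\<close>.
\<close>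

lemma connected_if_not_split_by:
  assumes "U \<noteq> {}" "\<not> split_by c i U"
  shows "connected_graph U {e \<in> complete_edges U. c e \<noteq> i}" (is "connected_graph U ?F")
  unfolding connected_graph_def
proof (intro conjI ballI)
  show "U \<noteq> {}" by fact
next
  fix u v assume u: "u \<in> U" and v: "v \<in> U"
  define R where "R = {(x, y). {x, y} \<in> ?F}"
  define X where "X = {x \<in> U. (u, x) \<in> R\<^sup>*}"
  have "c {x, y} = i" if x: "x \<in> X" and y: "y \<in> U - X" for x y
  proof (rule ccontr)
    assume "c {x, y} \<noteq> i"
    moreover have "x \<noteq> y" using x y by auto
    ultimately have "(x, y) \<in> R"
      using x y by (simp add: R_def X_def complete_edges_def)
    then show False using x y rtrancl_into_rtrancl[of u x R y] by (simp add: X_def)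
  qed
  moreover have "u \<in> X" using u by (simp add: X_def)
  ultimately have "U - X = {}"
    using assms(2) split_byI[of X "U - X" U c i] by (auto simp: X_def)
  then have "(u, v) \<in> R\<^sup>*" using v by (auto simp: X_def)
  then show "(u, v) \<in> {(x, y). {x, y} \<in> ?F}\<^sup>*" by (simp only: R_def)
qed

lemma k_connected_3_if_robust:
  assumes "finite W" "card W \<ge> 4" "robust c i W"
  shows "k_connected 3 W {e \<in> complete_edges W. c e \<noteq> i}" (is "k_connected 3 W ?F")
  unfolding k_connected_def
proof (intro conjI allI impI)
  show "graph W ?F" unfolding graph_def using assms(1) by blast
  show "card W > 3" using assms(2) by linarith
next
  fix S assume S: "S \<subseteq> W \<and> card S < 3"
  then have "W \<noteq> S" using assms(2) by auto
  then have "W - S \<noteq> {}" using S by blast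
  moreover have "\<not> split_by c i (W - S)" using S assms(3) unfolding robust_def by simp
  moreover have "{e \<in> ?F. e \<inter> S = {}} = {e \<in> complete_edges (W - S). c e \<noteq> i}"
    unfolding complete_edges_def by blast
  ultimately show "connected_graph (W - S) {e \<in> ?F. e \<inter> S = {}}"
    using connected_if_not_split_by[of "W - S" c i] by simp
qed

section \<open>Two vertices joined to all others\<close>

text \<open>
  Let \<open>r\<close> be a colour other than \<open>p\<close> and \<open>q\<close>. If \<open>B\<close> is not split by \<open>r\<close>, then
  everything is a double cone without \<open>r\<close>. If it is, and \<open>p = q\<close>, the remaining colour can
  be dropped instead of \<open>r\<close>. If \<open>p\<close> and \<open>q\<close> differ, \<open>q\<close> is the colour to drop: the vertex \<open>b\<close>
  is sacrificed and the other apex together with the two sides of \<open>B\<close> forms a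
  complete tripartite graph. This fails only if one side is a single vertex \<open>d\<close>; then
  two of the three vertices \<open>a\<close>, \<open>b\<close>, \<open>d\<close> are the apexes of a double cone over the other side.
\<close>

lemma two_apexes:
  assumes "finite C" "card C = 3" "p \<in> C" "q \<in> C"
    and "finite B" "card B \<ge> 5" "a \<notin> B" "b \<notin> B" "a \<noteq> b"
    and a: "\<And>x. x \<in> B \<Longrightarrow> c {a, x} = p" and b: "\<And>x. x \<in> B \<Longrightarrow> c {b, x} = q"
  shows "\<exists>i\<in>C. \<exists>W \<subseteq> {a, b} \<union> B. card W \<ge> card B + 1 \<and> robust c i W"
proof -
  have cone: ?thesis if "i \<in> C" "i \<noteq> p" "i \<noteq> q" "\<not> split_by c i B" for i
  proof -
    have "robust c i ({a, b} \<union> B)"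
      using that assms by (intro robust_double_cone) (auto simp: avoids_def)
    moreover have "card ({a, b} \<union> B) \<ge> card B + 1" using assms by simp
    ultimately show ?thesis using that by blast
  qed
  have "card {p, q} \<le> 2" by (simp add: card_insert_if)
  then have "\<not> C \<subseteq> {p, q}" using assms(2) card_mono[of "{p, q}" C] by auto
  then obtain r where r: "r \<in> C" "r \<noteq> p" "r \<noteq> q" by blast
  show ?thesis
  proof (cases "split_by c r B")
    case False
    then show ?thesis using cone r by blast
  next
    case split: True
    show ?thesis
    proof (cases "p = q")
      case True
      have "card {p, r} \<le> 2" by (simp add: card_insert_if)
      then have "\<not> C \<subseteq> {p, r}" using assms(2) card_mono[of "{p, r}" C] by auto
      then obtain j where j: "j \<in> C" "j \<noteq> p" "j \<noteq> r" by blast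
      have "\<not> split_by c j B" using not_split_by_two_colors[OF split] j(3) by metis
      with cone[of j] j True show ?thesis by simp
    next
      case pq: False
      obtain D E where DE: "D \<noteq> {}" "E \<noteq> {}" "D \<inter> E = {}" "D \<union> E = B"
          "\<forall>x\<in>D. \<forall>y\<in>E. c {x, y} = r" "card D \<le> card E"
          "card D + card E = card B" "finite D" "finite E"
        using split_byE[OF split \<open>finite B\<close>] .
      have aB: "avoids c q {a} B" using a pq by (simp add: avoids_def)
      have DE_q: "avoids c q D E" using DE(5) r by (simp add: avoids_def)
      show ?thesis
      proof (cases "card D \<ge> 2")
        case True
        let ?W = "insert a B"
        have diff: "?W - {a} = B" "?W - D = insert a E" "?W - E = insert a D"
          using \<open>a \<notin> B\<close> DE by auto
        have "a \<notin> D" "a \<notin> E" using \<open>a \<notin> B\<close> DE(4) by auto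
        then have "3 \<le> card B" "3 \<le> card (insert a E)" "3 \<le> card (insert a D)"
          using DE(6-9) True assms(6) by simp_all
        moreover have "avoids c q D (insert a E)" "avoids c q E (insert a D)"
          using avoids_sym[OF aB] DE_q avoids_sym[OF DE_q] DE(4) by (auto simp: avoids_def)
        ultimately have parts: "\<forall>P \<in> {{a}, D, E}. 3 \<le> card (?W - P) \<and> avoids c q P (?W - P)"
          using aB by (simp only: ball_simps diff)
        have "robust c q ?W"
        proof (rule robust_multipartite)
          show "\<exists>P\<subseteq>?W. w \<in> P \<and> 3 \<le> card (?W - P) \<and> avoids c q P (?W - P)"
            if "w \<in> ?W" for w
          proof -
            have "\<exists>P\<in>{{a}, D, E}. w \<in> P \<and> P \<subseteq> ?W" using that DE(4) by auto
            then show ?thesis using parts by blast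
          qed
        qed (use assms in auto)
        moreover have "card ?W = card B + 1" using assms by simp
        ultimately show ?thesis using \<open>q \<in> C\<close> by (intro bexI[of _ q] exI[of _ ?W]) auto
      next
        case False
        moreover have "card D \<noteq> 0" using DE by simp
        ultimately have "card D = 1" by simp
        then obtain d where d: "D = {d}" by (auto simp: card_1_singleton_iff)
        have dB: "d \<in> B" "d \<notin> E" "d \<noteq> a" "d \<noteq> b" "a \<notin> E" "b \<notin> E"
          using d DE(3,4) assms(7,8) by auto
        have card: "card E + 1 = card B" using DE(7) d by simp
        show ?thesis
        proof (cases "split_by c r E")
          case False
          have "robust c r ({a, b} \<union> E)"
            using False assms DE dB r card a b by (intro robust_double_cone) (auto simp: avoids_def)
          moreover have "card ({a, b} \<union> E) = card B + 1" using dB assms card DE by simp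
          ultimately show ?thesis using r DE(4) by (intro bexI[of _ r] exI[of _ "{a, b} \<union> E"]) auto
        next
          case True
          have "robust c q ({a, d} \<union> E)"
            using not_split_by_two_colors[OF True r(3)] assms DE d dB r card a pq
            by (intro robust_double_cone) (auto simp: avoids_def)
          moreover have "card ({a, d} \<union> E) = card B + 1" using dB assms card DE by simp
          ultimately show ?thesis
            using \<open>q \<in> C\<close> DE(4) dB by (intro bexI[of _ q] exI[of _ "{a, d} \<union> E"]) auto
        qed
      qed
    qed
  qed
qed

section \<open>Components of one colour\<close>

definition closed_in :: "('a set \<Rightarrow> 'c) \<Rightarrow> 'c \<Rightarrow> 'a set \<Rightarrow> 'a set \<Rightarrow> bool" where
  "closed_in c k U P \<longleftrightarrow> P \<subseteq> U \<and> avoids c k P (U - P)"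

text \<open>
  The connected component of \<open>w\<close> in colour \<open>k\<close>, as a least closed set instead of by paths: to show
  that a property holds on a whole component it is enough to see that it defines a closed set.
\<close>

definition component :: "('a set \<Rightarrow> 'c) \<Rightarrow> 'c \<Rightarrow> 'a set \<Rightarrow> 'a \<Rightarrow> 'a set" where
  "component c k U w = \<Inter>{P. closed_in c k U P \<and> w \<in> P}"

lemma component_least: "closed_in c k U P \<Longrightarrow> w \<in> P \<Longrightarrow> component c k U w \<subseteq> P"
  unfolding component_def by blast

lemma closed_in_Compl: "closed_in c k U P \<Longrightarrow> closed_in c k U (U - P)"
  unfolding closed_in_def by (simp add: avoids_sym double_diff)

lemma mem_component: "w \<in> component c k U w"
  unfolding component_def by blast

lemma closed_in_component: "w \<in> U \<Longrightarrow> closed_in c k U (component c k U w)"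
proof -
  assume w: "w \<in> U"
  then have "closed_in c k U U" by (simp add: closed_in_def avoids_def)
  then have "component c k U w \<subseteq> U" using w by (rule component_least)
  moreover have "c {x, y} \<noteq> k" if "x \<in> component c k U w" "y \<in> U - component c k U w" for x y
  proof -
    obtain P where "closed_in c k U P" "w \<in> P" "y \<notin> P"
      using \<open>y \<in> U - component c k U w\<close> unfolding component_def by blast
    moreover from this have "x \<in> P" using component_least that(1) by fast
    ultimately show ?thesis using that(2) by (auto simp: closed_in_def avoids_def)
  qed
  ultimately show ?thesis by (auto simp: closed_in_def avoids_def)
qed

lemma component_sym:
  assumes "x \<in> U" "y \<in> U" "y \<notin> component c k U x"
  shows "x \<notin> component c k U y"
proof -
  have "component c k U y \<subseteq> U - component c k U x"
    using assms by (intro component_least closed_in_Compl closed_in_component) auto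
  then show ?thesis using mem_component[of x c k U] by blast
qed

lemma component_psubset:
  assumes "closed_in c k U P" "P \<noteq> {}" "P \<noteq> U" "w \<in> U"
  shows "component c k U w \<subset> U"
proof (cases "w \<in> P")
  case True
  then have "component c k U w \<subseteq> P" using assms(1) by (intro component_least)
  then show ?thesis using assms(1,3) by (auto simp: closed_in_def)
next
  case False
  then have "component c k U w \<subseteq> U - P"
    using assms by (intro component_least closed_in_Compl) auto
  then show ?thesis using assms by (auto simp: closed_in_def)
qed

lemma component_color:
  assumes "w \<in> U" "x \<in> U - component c k U w" "y \<in> component c k U w"
  shows "c {x, y} \<noteq> k"
  using closed_in_component[OF assms(1), of c k] assms(2,3)
  by (auto simp: closed_in_def avoids_def insert_commute[of x y])

section \<open>Gallai colourings\<close>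

locale gallai =
  fixes V :: "'a set" and c :: "'a set \<Rightarrow> 'c" and C :: "'c set"
  assumes finite_V: "finite V" and finite_C: "finite C" and card_C: "card C = 3"
    and color: "x \<in> V \<Longrightarrow> y \<in> V \<Longrightarrow> x \<noteq> y \<Longrightarrow> c {x, y} \<in> C"
    and no_rainbow: "x \<in> V \<Longrightarrow> y \<in> V \<Longrightarrow> z \<in> V \<Longrightarrow> x \<noteq> y \<Longrightarrow> y \<noteq> z \<Longrightarrow> x \<noteq> z \<Longrightarrow>
      c {x, y} = c {y, z} \<or> c {y, z} = c {x, z} \<or> c {x, y} = c {x, z}"
begin

text \<open>
  Along an edge of colour \<open>k\<close> inside the component, the colour of the edge to \<open>x\<close> cannot
  change, since that would make a rainbow triangle. So the set on which it agrees with a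
  given one is closed.
\<close>

lemma component_monochromatic:
  assumes "U \<subseteq> V" "w \<in> U" "x \<in> U - component c k U w"
    and "y \<in> component c k U w" "z \<in> component c k U w"
  shows "c {x, y} = c {x, z}"
proof -
  let ?Q = "component c k U w"
  have Q: "closed_in c k U ?Q" by (rule closed_in_component) fact
  have *: "c {x, y} = c {x, w}" if y: "y \<in> ?Q" for y
  proof -
    let ?T = "{y \<in> ?Q. c {x, y} = c {x, w}}"
    have "c {t, s} \<noteq> k" if t: "t \<in> ?T" and s: "s \<in> U - ?T" for t s
    proof (cases "s \<in> ?Q")
      case False
      then show ?thesis using Q t s by (auto simp: closed_in_def avoids_def)
    next
      case True
      have xt: "c {x, t} \<noteq> k" "c {x, s} \<noteq> k"
        using component_color[OF assms(2,3)] t True by auto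
      have "c {x, t} \<noteq> c {x, s}" using t s True by auto
      moreover from this have "t \<noteq> s" by auto
      moreover have "x \<noteq> t" "x \<noteq> s" using assms(3) t True by auto
      moreover have "x \<in> V" "t \<in> V" "s \<in> V" using assms(1,3) Q t s by (auto simp: closed_in_def)
      ultimately show ?thesis using no_rainbow[of x t s] xt by auto
    qed
    then have "closed_in c k U ?T" using Q by (auto simp: closed_in_def avoids_def)
    then show ?thesis using component_least[of c k U ?T w] mem_component[of w c k U] y by blast
  qed
  show ?thesis using *[OF assms(4)] *[OF assms(5)] by simp
qed

text \<open>
  Induction on the number of vertices. Let colour \<open>k\<close> be disconnected before \<open>v\<close> is added,
  and suppose that afterwards all colours are connected. Then \<open>v\<close> sends an edge of colour \<open>k\<close>
  to each old component and also edges of the two other colours \<open>i\<close> and \<open>j\<close>, to \<open>x\<close>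
  and \<open>y\<close>, say. The absence of rainbow triangles forces all edges from \<open>x\<close> to other components
  to have colour \<open>i\<close>, and all those from \<open>y\<close> to have colour \<open>j\<close>. This is a contradiction both
  when \<open>x\<close> and \<open>y\<close> lie in one component and when they do not.
\<close>

lemma ex_disconnected_color:
  assumes "U \<subseteq> V" "card U \<ge> 2"
  shows "\<exists>k\<in>C. \<exists>P. closed_in c k U P \<and> P \<noteq> {} \<and> P \<noteq> U"
  using assms(2) assms(1)
proof (induction "card U - 2" arbitrary: U)
  case 0
  then have "card U = 2" by simp
  then obtain x y where U: "U = {x, y}" "x \<noteq> y" by (metis card_2_iff)
  have "\<not> C \<subseteq> {c {x, y}}" using card_C card_mono[of "{c {x, y}}" C] by auto
  then obtain k where "k \<in> C" "k \<noteq> c {x, y}" by blast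
  then show ?case using U by (intro bexI[of _ k] exI[of _ "{x}"]) (auto simp: closed_in_def avoids_def)
next
  case (Suc m)
  have finU: "finite U" using Suc.prems finite_V finite_subset by blast
  obtain v U' where U: "U = insert v U'" "v \<notin> U'" "card U' = Suc (Suc m)"
    using Suc.hyps(2) card_eq_SucD[of U "Suc (Suc m)"] by fastforce
  have finU': "finite U'" "U' \<subseteq> V" "v \<in> V" using U(1) finU Suc.prems(2) by simp_all
  obtain k P where k: "k \<in> C" and P: "closed_in c k U' P" "P \<noteq> {}" "P \<noteq> U'"
    using Suc.hyps(1)[of U'] U(3) finU'(2) by auto
  show ?case
  proof (rule ccontr)
    assume contra: "\<not> ?case"
    have v_edge: "\<exists>q\<in>Q. c {v, q} = l" if "l \<in> C" "closed_in c l U' Q" "Q \<noteq> {}" for l Q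
    proof (rule ccontr)
      assume "\<not> ?thesis"
      then have "closed_in c l U Q"
        using that U by (auto simp: closed_in_def avoids_def insert_commute)
      moreover have "Q \<noteq> U" using that U by (auto simp: closed_in_def)
      ultimately show False using contra that by blast
    qed
    have "U' \<noteq> {}" using P by (auto simp: closed_in_def)
    have see: "\<exists>x\<in>U'. c {v, x} = l" if "l \<in> C" for l
      using v_edge[of l U'] that \<open>U' \<noteq> {}\<close> by (simp add: closed_in_def avoids_def)
    have other: "c {x, z} = c {v, x}"
      if x: "x \<in> U'" "c {v, x} \<noteq> k" and z: "z \<in> U'" "z \<notin> component c k U' x" for x z
    proof -
      let ?Q = "component c k U' z"
      have Q: "closed_in c k U' ?Q" "z \<in> ?Q"
        using closed_in_component[OF z(1)] mem_component by fast+
      then obtain q where q: "q \<in> ?Q" "c {v, q} = k" using v_edge k by blast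
      have xQ: "x \<in> U' - ?Q" using component_sym[OF x(1) z] x by blast
      have "q \<in> U'" using q Q by (auto simp: closed_in_def)
      then have "v \<in> V" "x \<in> V" "q \<in> V" "v \<noteq> x" "x \<noteq> q" "v \<noteq> q"
        using q xQ x U finU' by auto
      from no_rainbow[OF this] have "c {x, q} = c {v, x}"
        using component_color[OF z(1) xQ q(1)] q x by auto
      then show ?thesis
        using component_monochromatic[OF finU'(2) z(1) xQ q(1) Q(2)] by simp
    qed
    have "card (C - {k}) = 2" using k card_C finite_C by simp
    then obtain i j where ij: "C - {k} = {i, j}" "i \<noteq> j" by (metis card_2_iff)
    obtain x where x: "x \<in> U'" "c {v, x} = i" using see[of i] ij by blast
    obtain y where y: "y \<in> U'" "c {v, y} = j" using see[of j] ij by blast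
    have ne: "i \<noteq> k" "j \<noteq> k" using ij by auto
    show False
    proof (cases "y \<in> component c k U' x")
      case False
      then have "c {x, y} = i" using other[of x y] x y ne by simp
      moreover have "c {y, x} = j"
        using other[of y x] component_sym[OF x(1) y(1) False] x y ne by simp
      ultimately show False using ij by (simp add: insert_commute)
    next
      case True
      have "component c k U' x \<subset> U'" using component_psubset[OF P x(1)] .
      then obtain z where z: "z \<in> U'" "z \<notin> component c k U' x" by blast
      have "z \<notin> component c k U' y"
        using component_least[OF closed_in_component[OF x(1)] True] z by blast
      then have "c {y, z} = j" "c {x, z} = i" using other[of y z] other[of x z] x y z ne by auto
      moreover have "c {z, x} = c {z, y}"
        using component_monochromatic[OF finU'(2) x(1) _ mem_component True] z by blast
      ultimately show False using ij by (simp add: insert_commute)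
    qed
  qed
qed

text \<open>
  When a component \<open>P\<close> of the disconnected colour misses two vertices \<open>r\<close> and \<open>s\<close>, these see
  \<open>P\<close> in one colour each. If the two colours agree, \<open>P\<close> is a side of a split; otherwise
  the edge \<open>rs\<close> has one of them, because with a vertex of \<open>P\<close> it makes no
  rainbow triangle, and \<open>r\<close> or \<open>s\<close> alone is a side.
\<close>

lemma split_or_robust:
  assumes "U \<subseteq> V" "card U \<ge> 2"
  shows "\<exists>i\<in>C. split_by c i U \<or> robust c i U"
proof -
  obtain k P0 where k: "k \<in> C" and P0: "closed_in c k U P0" "P0 \<noteq> {}" "P0 \<noteq> U"
    using ex_disconnected_color[OF assms] by blast
  have finU: "finite U" using assms finite_V finite_subset by blast
  show ?thesis
  proof (cases "\<forall>w\<in>U. card (U - component c k U w) \<ge> 3")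
    case True
    have "U \<noteq> {}" using assms(2) by auto
    then obtain u where "u \<in> U" by blast
    then have "card U \<ge> 3"
      using True card_mono[OF finU, of "U - component c k U u"] by fastforce
    moreover have "\<exists>P\<subseteq>U. w \<in> P \<and> 3 \<le> card (U - P) \<and> avoids c k P (U - P)" if "w \<in> U" for w
      using True closed_in_component[OF that, of c k] mem_component[of w c k U] that
      by (auto simp: closed_in_def)
    ultimately have "robust c k U" by (intro robust_multipartite finU)
    with k show ?thesis by blast
  next
    case False
    then obtain w where w: "w \<in> U" "card (U - component c k U w) < 3" by auto
    let ?P = "component c k U w"
    have wP: "w \<in> ?P" by (rule mem_component)
    have PU: "?P \<subseteq> U" using closed_in_component[OF w(1), of c k] by (simp add: closed_in_def)
    have mono: "\<exists>i\<in>C. \<forall>y\<in>?P. c {x, y} = i" if x: "x \<in> U - ?P" for x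
    proof
      show "\<forall>y\<in>?P. c {x, y} = c {x, w}"
        using component_monochromatic[OF assms(1) w(1) x _ wP] by blast
      show "c {x, w} \<in> C" using x wP w(1) assms(1) by (intro color) auto
    qed
    have "card (U - ?P) \<noteq> 0" using component_psubset[OF P0 w(1)] finU by auto
    with w(2) consider "card (U - ?P) = 1" | "card (U - ?P) = 2" by linarith
    then show ?thesis
    proof cases
      case 1
      then obtain r where r: "U - ?P = {r}" by (auto simp: card_1_singleton_iff)
      obtain \<alpha> where \<alpha>: "\<alpha> \<in> C" "\<forall>y\<in>?P. c {r, y} = \<alpha>" using mono[of r] r by blast
      have "split_by c \<alpha> U"
        using r wP PU \<alpha>(2) by (intro split_byI[of "{r}" ?P]) auto
      then show ?thesis using \<alpha>(1) by blast
    next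
      case 2
      then obtain r s where rs: "U - ?P = {r, s}" "r \<noteq> s" by (metis card_2_iff)
      have U: "U = insert r (insert s ?P)" using rs PU by auto
      have notP: "r \<notin> ?P" "s \<notin> ?P" using rs by auto
      obtain \<alpha> where \<alpha>: "\<alpha> \<in> C" "\<forall>y\<in>?P. c {r, y} = \<alpha>" using mono[of r] rs by blast
      obtain \<beta> where \<beta>: "\<beta> \<in> C" "\<forall>y\<in>?P. c {s, y} = \<beta>" using mono[of s] rs by blast
      have "r \<in> V" "s \<in> V" "w \<in> V" "s \<noteq> w" "r \<noteq> w"
        using rs notP wP U assms(1) by auto
      then have "c {r, s} = \<beta> \<or> \<beta> = \<alpha> \<or> c {r, s} = \<alpha>"
        using no_rainbow[of r s w] rs(2) \<alpha>(2) \<beta>(2) wP by simp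
      moreover have "split_by c \<alpha> U" if "\<beta> = \<alpha>"
        using that \<alpha>(2) \<beta>(2) wP notP U by (intro split_byI[of "{r, s}" ?P]) auto
      moreover have "split_by c \<alpha> U" if "c {r, s} = \<alpha>"
        using that \<alpha>(2) notP U rs(2) by (intro split_byI[of "{r}" "insert s ?P"]) auto
      moreover have "split_by c \<beta> U" if "c {r, s} = \<beta>"
        using that \<beta>(2) notP U rs(2)
        by (intro split_byI[of "{s}" "insert r ?P"]) (auto simp: insert_commute[of s r])
      moreover note \<alpha>(1) \<beta>(1)
      ultimately show ?thesis by blast
    qed
  qed
qed

lemma ex_color_avoiding:
  obtains i where "i \<in> C" "i \<noteq> p" "i \<noteq> q"
proof -
  have "card {p, q} \<le> 2" by (simp add: card_insert_if)
  then have "\<not> C \<subseteq> {p, q}" using card_C card_mono[of "{p, q}" C] by auto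
  then show thesis using that by blast
qed

lemma ex_large_robust:
  assumes "card V \<ge> 7"
  shows "\<exists>i\<in>C. \<exists>W\<subseteq>V. card W \<ge> card V - 1 \<and> robust c i W"
proof -
  obtain p where p: "p \<in> C" "split_by c p V \<or> robust c p V"
    using split_or_robust[of V] assms by auto
  show ?thesis
  proof (cases "robust c p V")
    case True
    then show ?thesis using p by (intro bexI[of _ p] exI[of _ V]) auto
  next
    case False
    then have split: "split_by c p V" using p by blast
    obtain A B where AB: "A \<noteq> {}" "B \<noteq> {}" "A \<inter> B = {}" "A \<union> B = V"
        "\<forall>x\<in>A. \<forall>y\<in>B. c {x, y} = p" "card A \<le> card B"
        "card A + card B = card V" "finite A" "finite B"
      using split_byE[OF split finite_V] .
    have "card A \<noteq> 0" using AB by simp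
    then consider "card A \<ge> 3" | "card A = 2" | "card A = 1" by linarith
    then show ?thesis
    proof cases
      case 1
      obtain i where i: "i \<in> C" "i \<noteq> p" using ex_color_avoiding[of p p] by blast
      have "robust c i (A \<union> B)"
        using 1 AB i by (intro robust_bipartite) (auto simp: avoids_def)
      then show ?thesis using AB i by (intro bexI[of _ i] exI[of _ V]) auto
    next
      case 2
      then obtain a b where ab: "A = {a, b}" "a \<noteq> b" by (metis card_2_iff)
      have "\<exists>i\<in>C. \<exists>W\<subseteq>{a, b} \<union> B. card B + 1 \<le> card W \<and> robust c i W"
        using ab AB 2 assms p finite_C card_C by (intro two_apexes[where p = p and q = p]) auto
      moreover have "{a, b} \<union> B = V" "card B + 1 = card V - 1" using AB(4,7) ab(1) 2 by auto
      ultimately show ?thesis by simp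
    next
      case 3
      then obtain a where a: "A = {a}" by (auto simp: card_1_singleton_iff)
      have cardB: "card B = card V - 1" using 3 AB by simp
      have BV: "B \<subseteq> V" using AB by auto
      obtain q where q: "q \<in> C" "split_by c q B \<or> robust c q B"
        using split_or_robust[OF BV] assms cardB by fastforce
      show ?thesis
      proof (cases "robust c q B")
        case True
        then show ?thesis using q BV cardB by (intro bexI[of _ q] exI[of _ B]) auto
      next
        case False
        then have split: "split_by c q B" using q by blast
        obtain D E where DE: "D \<noteq> {}" "E \<noteq> {}" "D \<inter> E = {}" "D \<union> E = B"
            "\<forall>x\<in>D. \<forall>y\<in>E. c {x, y} = q" "card D \<le> card E"
            "card D + card E = card B" "finite D" "finite E"
          using split_byE[OF split AB(9)] .
        have aB: "a \<notin> B" "a \<notin> D" "a \<notin> E" using a AB(3) DE(4) by auto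
        have V: "V = insert a D \<union> E" using AB(4) a DE(4) by auto
        have pE: "c {a, x} = p" if "x \<in> E" for x using AB(5) a DE(4) that by auto
        show ?thesis
        proof (cases "card D \<ge> 2")
          case True
          obtain i where i: "i \<in> C" "i \<noteq> p" "i \<noteq> q" using ex_color_avoiding .
          have "robust c i (insert a D \<union> E)"
            using True aB DE pE i assms cardB by (intro robust_bipartite) (auto simp: avoids_def)
          then show ?thesis using V i by (intro bexI[of _ i] exI[of _ V]) auto
        next
          case False
          moreover have "card D \<noteq> 0" using DE by simp
          ultimately have "card D = 1" by simp
          then obtain d where d: "D = {d}" by (auto simp: card_1_singleton_iff)
          have cardE: "card E = card V - 2" using cardB DE(7) d by simp
          have "\<exists>i\<in>C. \<exists>W\<subseteq>{a, d} \<union> E. card E + 1 \<le> card W \<and> robust c i W"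
            using d DE aB assms p q finite_C card_C pE cardE
            by (intro two_apexes[where p = p and q = q]) auto
          moreover have "{a, d} \<union> E = V" "card E + 1 = card V - 1"
            using V d cardE assms by auto
          ultimately show ?thesis by simp
        qed
      qed
    qed
  qed
qed

end

theorem lemma5p4:
  fixes n :: nat and V :: "'a set" and c :: "'a set \<Rightarrow> 'c"
  assumes "n \<ge> 7"
    and "finite V" and "card V = n"
    and "gallai_3_coloring V c"
  shows "\<exists>W F. subgraph W F V (complete_edges V) \<and> k_connected 3 W F \<and>
           card W \<ge> n - 1 \<and> card (c ` F) \<le> 2"
proof -
  let ?C = "c ` complete_edges V"
  have cardC: "card ?C = 3" using assms(4) by (simp add: gallai_3_coloring_def)
  then have finC: "finite ?C" by (simp add: card_ge_0_finite)
  interpret gallai V c ?C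
  proof
    show "c {x, y} \<in> ?C" if "x \<in> V" "y \<in> V" "x \<noteq> y" for x y
      using that by (intro imageI) (simp add: complete_edges_def)
    show "c {x, y} = c {y, z} \<or> c {y, z} = c {x, z} \<or> c {x, y} = c {x, z}"
      if "x \<in> V" "y \<in> V" "z \<in> V" "x \<noteq> y" "y \<noteq> z" "x \<noteq> z" for x y z
      using assms(4) that unfolding gallai_3_coloring_def by blast
  qed (use assms cardC finC in auto)
  obtain i W where i: "i \<in> ?C" and W: "W \<subseteq> V" "card W \<ge> n - 1" "robust c i W"
    using ex_large_robust assms by auto
  let ?F = "{e \<in> complete_edges W. c e \<noteq> i}"
  have finW: "finite W" using W assms finite_subset by blast
  have sub: "complete_edges W \<subseteq> complete_edges V" using W by (auto simp: complete_edges_def)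
  have "subgraph W ?F V (complete_edges V)"
    using sub W finW assms by (auto simp: subgraph_def graph_def)
  moreover have "k_connected 3 W ?F"
    using finW W assms by (intro k_connected_3_if_robust) auto
  moreover have "card (c ` ?F) \<le> card (?C - {i})"
    using sub finC by (intro card_mono) auto
  then have "card (c ` ?F) \<le> 2" using i cardC finC by simp
  ultimately show ?thesis using W by blast
qed

end
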